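(* The positively graded nilpotent Lie algebras $\mathfrak D(4m)$ (for every integer $m\ge1$) and $\mathfrak D(4m+1)$ (for every integer $m\ge0$) admit complex structures.
   Context: For $n\ge1$, $\mathfrak D(n)=\bigoplus_{l=1}^n\mathfrak D_l$ is the positively graded real Lie algebra defined as follows. For odd $l\le n$, $\mathfrak D_l$ is two-dimensional with basis $v_l,u_l$; for even $l\le n$, $\mathfrak D_l$ is one-dimensional with basis $w_l$. For odd positive $i,l\le n$ and even positive $j\le n$ the brackets are $$[v_i,w_j]=u_{i+j}\ \text{if } i+j\le n,\quad [w_j,u_l]=v_{j+l}\ \text{if } j+l\le n,\quad [u_l,v_i]=w_{l+i}\ \text{if } l+i\le n,$$ each of these brackets being zero if the resulting index exceeds $n$; all other brackets of basis elements not determined by antisymmetry are zero. A complex structure on a real Lie algebra $\mathfrak g$ is a linear endomorphism $J$ of $\mathfrak g$ with $J^2=-1$ and $[JX,JY]=[X,Y]+J[JX,Y]+J[X,JY]$ for all $X,Y\in\mathfrak g$. *)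

theory Defs
  imports "HOL-Analysis.Analysis" "HOL-Analysis.Finite_Function_Topology"
begin

section \<open>Real Lie algebras on a subspace of a real vector space\<close>

text \<open>A Lie algebra is a subspace \<open>L\<close> of an ambient real vector space together with a bracket,
  of which only the values on \<open>L\<close> matter.\<close>

definition lie_algebra_on :: "'a::real_vector set \<Rightarrow> ('a \<Rightarrow> 'a \<Rightarrow> 'a) \<Rightarrow> bool" where
  "lie_algebra_on L br \<longleftrightarrow>
     subspace L \<and>
     (\<forall>x\<in>L. \<forall>y\<in>L. br x y \<in> L) \<and>
     (\<forall>x\<in>L. \<forall>y\<in>L. \<forall>z\<in>L. br (x + y) z = br x z + br y z \<and> br x (y + z) = br x y + br x z) \<and>
     (\<forall>c. \<forall>x\<in>L. \<forall>y\<in>L. br (c *\<^sub>R x) y = c *\<^sub>R br x y \<and> br x (c *\<^sub>R y) = c *\<^sub>R br x y) \<and>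
     (\<forall>x\<in>L. br x x = 0) \<and>
     (\<forall>x\<in>L. \<forall>y\<in>L. \<forall>z\<in>L. br x (br y z) + br y (br z x) + br z (br x y) = 0)"

text \<open>The second line says that \<open>L\<close> is the (internal) direct sum of the \<open>G l\<close>. The grading is
  positive: the component of degree 0 is trivial.\<close>

definition positive_grading_on ::
    "'a::real_vector set \<Rightarrow> ('a \<Rightarrow> 'a \<Rightarrow> 'a) \<Rightarrow> (nat \<Rightarrow> 'a set) \<Rightarrow> bool" where
  "positive_grading_on L br G \<longleftrightarrow>
     G 0 = {0} \<and> (\<forall>l. subspace (G l) \<and> G l \<subseteq> L) \<and>
     (\<forall>x\<in>L. \<exists>!c. (\<forall>l. c l \<in> G l) \<and> finite {l. c l \<noteq> 0} \<and> x = (\<Sum>l | c l \<noteq> 0. c l)) \<and>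
     (\<forall>i j. \<forall>x\<in>G i. \<forall>y\<in>G j. br x y \<in> G (i + j))"

primrec lower_central ::
    "'a::real_vector set \<Rightarrow> ('a \<Rightarrow> 'a \<Rightarrow> 'a) \<Rightarrow> nat \<Rightarrow> 'a set" where
  "lower_central L br 0 = L"
| "lower_central L br (Suc k) = span {br x y | x y. x \<in> L \<and> y \<in> lower_central L br k}"

definition nilpotent_on :: "'a::real_vector set \<Rightarrow> ('a \<Rightarrow> 'a \<Rightarrow> 'a) \<Rightarrow> bool" where
  "nilpotent_on L br \<longleftrightarrow> (\<exists>k. lower_central L br k = {0})"

definition linear_endomorphism_on :: "'a::real_vector set \<Rightarrow> ('a \<Rightarrow> 'a) \<Rightarrow> bool" where
  "linear_endomorphism_on L J \<longleftrightarrow>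
     (\<forall>x\<in>L. J x \<in> L) \<and>
     (\<forall>x\<in>L. \<forall>y\<in>L. J (x + y) = J x + J y) \<and>
     (\<forall>c. \<forall>x\<in>L. J (c *\<^sub>R x) = c *\<^sub>R J x)"

definition complex_structure_on ::
    "'a::real_vector set \<Rightarrow> ('a \<Rightarrow> 'a \<Rightarrow> 'a) \<Rightarrow> ('a \<Rightarrow> 'a) \<Rightarrow> bool" where
  "complex_structure_on L br J \<longleftrightarrow>
     linear_endomorphism_on L J \<and>
     (\<forall>x\<in>L. J (J x) = - x) \<and>
     (\<forall>x\<in>L. \<forall>y\<in>L. br (J x) (J y) = br x y + J (br (J x) y) + J (br x (J y)))"


section \<open>The Lie algebras \<open>D n\<close>\<close>

text \<open>Names of the basis vectors $v_l$, $u_l$, $w_l$. The ambient space of all \<open>D n\<close> is the real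
  vector space of finitely supported functions on these names, so the \<open>bvec b\<close> are linearly
  independent.\<close>

datatype bname = V nat | U nat | W nat

abbreviation bvec :: "bname \<Rightarrow> (bname \<Rightarrow>\<^sub>0 real)" where
  "bvec b \<equiv> Poly_Mapping.single b 1"

definition D_comp :: "nat \<Rightarrow> nat \<Rightarrow> (bname \<Rightarrow>\<^sub>0 real) set" where
  "D_comp n l =
     (if l = 0 \<or> l > n then {0}
      else if odd l then span {bvec (V l), bvec (U l)}
      else span {bvec (W l)})"

definition D :: "nat \<Rightarrow> (bname \<Rightarrow>\<^sub>0 real) set" where
  "D n = span (\<Union>l\<in>{1..n}. D_comp n l)"

definition trunc_bvec :: "nat \<Rightarrow> (nat \<Rightarrow> bname) \<Rightarrow> nat \<Rightarrow> (bname \<Rightarrow>\<^sub>0 real)" where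
  "trunc_bvec n B k = (if k \<le> n then bvec (B k) else 0)"

text \<open>Parities are not tested here: names with an index of the wrong parity do not occur in
  elements of \<open>D n\<close>.\<close>

fun basis_bracket :: "nat \<Rightarrow> bname \<Rightarrow> bname \<Rightarrow> (bname \<Rightarrow>\<^sub>0 real)" where
  "basis_bracket n (V i) (W j) = trunc_bvec n U (i + j)"
| "basis_bracket n (W j) (V i) = - trunc_bvec n U (i + j)"
| "basis_bracket n (W j) (U l) = trunc_bvec n V (j + l)"
| "basis_bracket n (U l) (W j) = - trunc_bvec n V (j + l)"
| "basis_bracket n (U l) (V i) = trunc_bvec n W (l + i)"
| "basis_bracket n (V i) (U l) = - trunc_bvec n W (l + i)"
| "basis_bracket n _ _ = 0"

definition D_bracket ::
    "nat \<Rightarrow> (bname \<Rightarrow>\<^sub>0 real) \<Rightarrow> (bname \<Rightarrow>\<^sub>0 real) \<Rightarrow> (bname \<Rightarrow>\<^sub>0 real)" where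
  "D_bracket n x y =
     (\<Sum>a\<in>Poly_Mapping.keys x. \<Sum>b\<in>Poly_Mapping.keys y.
        (Poly_Mapping.lookup x a * Poly_Mapping.lookup y b) *\<^sub>R basis_bracket n a b)"

lemma D_bracket_bvec: "D_bracket n (bvec a) (bvec b) = basis_bracket n a b"
  by (simp add: D_bracket_def)

end

theory Submission
  imports Defs
begin

text \<open>In the complexification, the vectors $z_l = v_l - i u_l$ commute with each other and
  satisfy $[w_j, z_l] = -i z_{j+l}$. Hence for any pairing of the even degrees
  the span of all $z_l$ and all $w_j - i w_{j'}$, with $(j, j')$ a pair, is a subalgebra
  complementary to its conjugate, i.e. the $(1,0)$-space of a complex structure. The even
  degrees up to $4m$ or $4m+1$ are $2m$ in number, so they can be paired.\<close>

section \<open>Linear maps on finitely supported functions\<close>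

lemma lookup_scaleR [simp]:
  "Poly_Mapping.lookup (c *\<^sub>R x) a = c *\<^sub>R Poly_Mapping.lookup x a"
proof -
  have "finite {a. c *\<^sub>R Poly_Mapping.lookup x a \<noteq> 0}"
    by (rule finite_subset[OF _ finite_lookup[of x]]) auto
  then show ?thesis
    by (simp add: scaleR_poly_mapping_def)
qed

text \<open>The universal property of the free vector space. It serves for the bracket in each
  argument, the projections to the graded components, and the complex structure.\<close>

definition lin_ext :: "('b \<Rightarrow> 'a::real_vector) \<Rightarrow> ('b \<Rightarrow>\<^sub>0 real) \<Rightarrow> 'a" where
  "lin_ext f x = (\<Sum>a\<in>Poly_Mapping.keys x. Poly_Mapping.lookup x a *\<^sub>R f a)"

lemma lin_ext_superset:
  "finite A \<Longrightarrow> Poly_Mapping.keys x \<subseteq> A \<Longrightarrow>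
    lin_ext f x = (\<Sum>a\<in>A. Poly_Mapping.lookup x a *\<^sub>R f a)"
  unfolding lin_ext_def by (rule sum.mono_neutral_left) (auto simp: in_keys_iff)

lemma linear_lin_ext: "linear (lin_ext f)"
proof (rule linearI)
  fix x y :: "'a \<Rightarrow>\<^sub>0 real" and c :: real
  let ?A = "Poly_Mapping.keys x \<union> Poly_Mapping.keys y"
  show "lin_ext f (x + y) = lin_ext f x + lin_ext f y"
    using keys_add[of x y]
    by (simp add: lin_ext_superset[of ?A] lookup_add scaleR_add_left sum.distrib)
  have "Poly_Mapping.keys (c *\<^sub>R x) \<subseteq> Poly_Mapping.keys x"
    by (auto simp: in_keys_iff)
  then show "lin_ext f (c *\<^sub>R x) = c *\<^sub>R lin_ext f x"
    by (simp add: lin_ext_superset[of "Poly_Mapping.keys x"] scaleR_sum_right)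
qed

lemma lin_ext_bvec [simp]: "lin_ext f (Poly_Mapping.single a 1) = f a"
  by (simp add: lin_ext_def)

lemma lin_ext_single_id: "lin_ext (\<lambda>a. Poly_Mapping.single a 1) x = x"
proof (rule poly_mapping_eqI)
  fix b
  have "Poly_Mapping.lookup (lin_ext (\<lambda>a. Poly_Mapping.single a 1) x) b
      = (\<Sum>a\<in>Poly_Mapping.keys x. if a = b then Poly_Mapping.lookup x a else 0)"
    unfolding lin_ext_def lookup_sum by (intro sum.cong) (auto simp: lookup_single when_def)
  also have "\<dots> = Poly_Mapping.lookup x b"
    by (simp add: in_keys_iff)
  finally show "Poly_Mapping.lookup (lin_ext (\<lambda>a. Poly_Mapping.single a 1) x) b
      = Poly_Mapping.lookup x b" .
qed

text \<open>Turns spans of basis vectors into conditions on the support, so that membership in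
  \<open>D n\<close> and its components can be checked name by name.\<close>

lemma span_single:
  "span ((\<lambda>a. Poly_Mapping.single a (1::real)) ` S) = {x. Poly_Mapping.keys x \<subseteq> S}"
proof
  have "subspace {x :: _ \<Rightarrow>\<^sub>0 real. Poly_Mapping.keys x \<subseteq> S}"
    unfolding subspace_def subset_iff in_keys_iff mem_Collect_eq
    by (auto simp: lookup_add) (metis add_0)
  then show "span ((\<lambda>a. Poly_Mapping.single a (1::real)) ` S) \<subseteq> {x. Poly_Mapping.keys x \<subseteq> S}"
    by (intro span_minimal) auto
  show "{x. Poly_Mapping.keys x \<subseteq> S} \<subseteq> span ((\<lambda>a. Poly_Mapping.single a (1::real)) ` S)"
  proof
    fix x :: "_ \<Rightarrow>\<^sub>0 real"
    assume "x \<in> {x. Poly_Mapping.keys x \<subseteq> S}"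
    then have "lin_ext (\<lambda>a. Poly_Mapping.single a 1) x
        \<in> span ((\<lambda>a. Poly_Mapping.single a (1::real)) ` S)"
      unfolding lin_ext_def by (intro span_sum span_scale span_base) auto
    then show "x \<in> span ((\<lambda>a. Poly_Mapping.single a (1::real)) ` S)"
      by (simp add: lin_ext_single_id)
  qed
qed

text \<open>Only names in the support of the given \<open>x\<close> are tested, so a property of the
  names occurring in \<open>x\<close> is available at each basis vector.\<close>

lemma linear_eq_bvec:
  fixes f g :: "('b \<Rightarrow>\<^sub>0 real) \<Rightarrow> 'a::real_vector"
  assumes "linear f" "linear g"
    and "\<And>a. a \<in> Poly_Mapping.keys x \<Longrightarrow> f (Poly_Mapping.single a 1) = g (Poly_Mapping.single a 1)"
  shows "f x = g x"
proof (rule linear_eq_on_span[OF assms(1,2)])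
  show "x \<in> span ((\<lambda>a. Poly_Mapping.single a (1::real)) ` Poly_Mapping.keys x)"
    by (simp add: span_single)
qed (use assms(3) in auto)

lemma linear_in_subspace:
  fixes f :: "('b \<Rightarrow>\<^sub>0 real) \<Rightarrow> 'a::real_vector"
  assumes "linear f" "subspace T" "\<And>a. a \<in> Poly_Mapping.keys x \<Longrightarrow> f (Poly_Mapping.single a 1) \<in> T"
  shows "f x \<in> T"
proof -
  have "f x = (\<Sum>a\<in>Poly_Mapping.keys x. Poly_Mapping.lookup x a *\<^sub>R f (Poly_Mapping.single a 1))"
    using linear_eq_bvec[OF assms(1) linear_lin_ext[of "\<lambda>a. f (Poly_Mapping.single a 1)"], of x]
    by (simp add: lin_ext_def)
  also have "\<dots> \<in> T"
    using assms by (intro subspace_sum subspace_scale) auto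
  finally show ?thesis .
qed

lemma subspace_keys: "subspace {x :: 'b \<Rightarrow>\<^sub>0 real. Poly_Mapping.keys x \<subseteq> S}"
  unfolding span_single[symmetric] by (rule subspace_span)


section \<open>The bracket\<close>

lemma linear_D_bracket_left: "linear (\<lambda>x. D_bracket n x y)"
proof -
  have "(\<lambda>x. D_bracket n x y) = lin_ext (\<lambda>a. lin_ext (basis_bracket n a) y)"
    by (auto simp: D_bracket_def lin_ext_def scaleR_sum_right)
  then show ?thesis by (simp add: linear_lin_ext)
qed

lemma linear_D_bracket_right: "linear (\<lambda>y. D_bracket n x y)"
proof -
  have "(\<lambda>y. D_bracket n x y)
      = (\<lambda>y. \<Sum>a\<in>Poly_Mapping.keys x. Poly_Mapping.lookup x a *\<^sub>R lin_ext (basis_bracket n a) y)"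
    by (auto simp: D_bracket_def lin_ext_def scaleR_sum_right)
  moreover have "linear \<dots>"
    by (intro linear_compose_sum ballI linear_compose_scale_right linear_lin_ext)
  ultimately show ?thesis by simp
qed

lemmas D_bracket_linear =
  linear_add[OF linear_D_bracket_left] linear_add[OF linear_D_bracket_right]
  linear_cmul[OF linear_D_bracket_left] linear_cmul[OF linear_D_bracket_right]
  linear_neg[OF linear_D_bracket_left] linear_neg[OF linear_D_bracket_right]
  linear_0[OF linear_D_bracket_left] linear_0[OF linear_D_bracket_right]

lemma bilinear_D_bracket_eq:
  assumes "\<And>y. linear (\<lambda>x. f x y)" "\<And>x. linear (f x)"
    and "\<And>y. linear (\<lambda>x. g x y)" "\<And>x. linear (g x)"
    and "\<And>a b. a \<in> Poly_Mapping.keys x \<Longrightarrow> b \<in> Poly_Mapping.keys y \<Longrightarrow>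
      f (bvec a) (bvec b) = g (bvec a) (bvec b)"
  shows "f x y = g x y"
  by (rule linear_eq_bvec[OF assms(1,3)], rule linear_eq_bvec[OF assms(2,4)], rule assms(5))

lemma D_bracket_in_subspace:
  assumes "subspace T"
    and "\<And>a b. a \<in> Poly_Mapping.keys x \<Longrightarrow> b \<in> Poly_Mapping.keys y \<Longrightarrow> basis_bracket n a b \<in> T"
  shows "D_bracket n x y \<in> T"
  by (rule linear_in_subspace[OF linear_D_bracket_left assms(1)],
      rule linear_in_subspace[OF linear_D_bracket_right assms(1)])
    (simp add: D_bracket_bvec assms(2))

lemma D_bracket_antisym: "D_bracket n x y = - D_bracket n y x"
proof (rule bilinear_D_bracket_eq[where f = "D_bracket n" and g = "\<lambda>x y. - D_bracket n y x"])
  show "D_bracket n (bvec a) (bvec b) = - D_bracket n (bvec b) (bvec a)" for a b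
    by (cases a; cases b) (auto simp: D_bracket_bvec)
qed (auto intro!: linearI simp: D_bracket_linear)

lemma D_bracket_self: "D_bracket n x x = 0"
proof -
  have "D_bracket n x x + D_bracket n x x = 0"
    using D_bracket_antisym[of n x x] by (metis add.right_inverse)
  then show ?thesis by (simp flip: scaleR_2)
qed

text \<open>\<open>D n\<close> sits inside $\mathfrak{so}(3)$ tensored with the polynomials in $t$ modulo $t^{n+1}$,
  so the identity holds even for names with an index of the wrong parity.\<close>

lemma D_bracket_jacobi:
  "D_bracket n x (D_bracket n y z) + D_bracket n y (D_bracket n z x)
     + D_bracket n z (D_bracket n x y) = 0" (is "?jac x y z = 0")
proof -
  \<comment> \<open>Truncation does no harm: all three terms have the same total index, and if it is
    at most \<open>n\<close>, so is the index of every inner bracket.\<close>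
  have basis: "?jac (bvec a) (bvec b) (bvec c) = 0" for a b c
    by (cases a; cases b; cases c)
      (auto simp: D_bracket_bvec trunc_bvec_def D_bracket_linear algebra_simps)
  have lin: "linear (\<lambda>x. ?jac x y z)" "linear (\<lambda>y. ?jac x y z)" "linear (\<lambda>z. ?jac x y z)" for x y z
    by (auto intro!: linearI simp: D_bracket_linear scaleR_add_right)
  have "?jac (bvec a) (bvec b) z = 0" for a b z
    by (rule linear_eq_bvec[OF lin(3) linear_zero]) (rule basis)
  then have "?jac (bvec a) y z = 0" for a y z
    by (rule linear_eq_bvec[OF lin(2) linear_zero])
  then show ?thesis
    by (rule linear_eq_bvec[OF lin(1) linear_zero])
qed


section \<open>Basis names and the grading\<close>

fun deg :: "bname \<Rightarrow> nat" where
  "deg (V l) = l"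
| "deg (U l) = l"
| "deg (W l) = l"

text \<open>Supplies the parity condition that \<open>basis_bracket\<close> leaves untested.\<close>

fun good_parity :: "bname \<Rightarrow> bool" where
  "good_parity (V l) = odd l"
| "good_parity (U l) = odd l"
| "good_parity (W l) = even l"

definition D_names :: "nat \<Rightarrow> bname set" where
  "D_names n = {a. good_parity a \<and> 0 < deg a \<and> deg a \<le> n}"

lemma D_comp_eq: "D_comp n l = {x. Poly_Mapping.keys x \<subseteq> {a \<in> D_names n. deg a = l}}"
proof -
  let ?S = "{a \<in> D_names n. deg a = l}"
  have "l = 0 \<or> l > n \<Longrightarrow> ?S = {}"
    by (auto simp: D_names_def)
  moreover have "odd l \<Longrightarrow> l \<le> n \<Longrightarrow> ?S = {V l, U l}"
    by (auto simp: D_names_def odd_pos elim: good_parity.elims)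
  moreover have "even l \<Longrightarrow> 0 < l \<Longrightarrow> l \<le> n \<Longrightarrow> ?S = {W l}"
    by (auto simp: D_names_def elim: good_parity.elims)
  ultimately have "D_comp n l = span (bvec ` ?S)"
    unfolding D_comp_def
    by (cases "l = 0 \<or> l > n"; cases "odd l") (simp_all del: Collect_empty_eq)
  then show ?thesis by (simp add: span_single)
qed

lemma D_eq: "D n = {x. Poly_Mapping.keys x \<subseteq> D_names n}"
proof
  show "D n \<subseteq> {x. Poly_Mapping.keys x \<subseteq> D_names n}"
    unfolding D_def by (rule span_minimal[OF _ subspace_keys]) (auto simp: D_comp_eq)
  have "bvec a \<in> (\<Union>l\<in>{1..n}. D_comp n l)" if "a \<in> D_names n" for a
    using that by (auto simp: D_comp_eq D_names_def)
  then show "{x. Poly_Mapping.keys x \<subseteq> D_names n} \<subseteq> D n"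
    unfolding D_def span_single[symmetric] by (intro span_mono) auto
qed

text \<open>Parities match: odd plus even is odd, as for \<open>U\<close> and \<open>V\<close>, and
  odd plus odd is even, as for \<open>W\<close>. Truncation keeps the degree at most
  \<open>n\<close>.\<close>

lemma keys_basis_bracket:
  assumes "a \<in> D_names n" "b \<in> D_names n"
  shows "Poly_Mapping.keys (basis_bracket n a b) \<subseteq> {c \<in> D_names n. deg c = deg a + deg b}"
  using assms by (cases a; cases b) (auto simp: D_names_def trunc_bvec_def split: if_splits)

text \<open>One support estimate with a free target \<open>S\<close>: it gives closure of
  \<open>D n\<close>, additivity of degrees, and the descent of the lower central series.\<close>

lemma keys_D_bracket:
  assumes "Poly_Mapping.keys x \<subseteq> D_names n" "Poly_Mapping.keys y \<subseteq> D_names n"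
    and "\<And>a b c. a \<in> Poly_Mapping.keys x \<Longrightarrow> b \<in> Poly_Mapping.keys y \<Longrightarrow> c \<in> D_names n \<Longrightarrow>
      deg c = deg a + deg b \<Longrightarrow> c \<in> S"
  shows "Poly_Mapping.keys (D_bracket n x y) \<subseteq> S"
proof -
  have "basis_bracket n a b \<in> {z. Poly_Mapping.keys z \<subseteq> S}"
    if "a \<in> Poly_Mapping.keys x" "b \<in> Poly_Mapping.keys y" for a b
    using that assms keys_basis_bracket[of a n b] by blast
  from D_bracket_in_subspace[OF subspace_keys this] show ?thesis by simp
qed

lemma lie_algebra_D: "lie_algebra_on (D n) (D_bracket n)"
  unfolding lie_algebra_on_def
proof (intro conjI ballI allI)
  show "subspace (D n)" by (simp add: D_eq subspace_keys)
  show "D_bracket n x y \<in> D n" if "x \<in> D n" "y \<in> D n" for x y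
    using that keys_D_bracket[of x n y "D_names n"] by (auto simp: D_eq)
qed (rule D_bracket_linear D_bracket_self D_bracket_jacobi)+

lemma positive_grading_D: "positive_grading_on (D n) (D_bracket n) (D_comp n)"
  unfolding positive_grading_on_def
proof (intro conjI ballI allI)
  show "D_comp n 0 = {0}" by (simp add: D_comp_def)
  show "subspace (D_comp n l)" for l by (simp add: D_comp_eq subspace_keys)
  show "D_comp n l \<subseteq> D n" for l by (auto simp: D_comp_eq D_eq)
  show "D_bracket n x y \<in> D_comp n (i + j)" if "x \<in> D_comp n i" "y \<in> D_comp n j" for x y i j
  proof -
    have x: "Poly_Mapping.keys x \<subseteq> {a \<in> D_names n. deg a = i}"
      and y: "Poly_Mapping.keys y \<subseteq> {a \<in> D_names n. deg a = j}"
      using that by (simp_all add: D_comp_eq)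
    have "Poly_Mapping.keys (D_bracket n x y) \<subseteq> {a \<in> D_names n. deg a = i + j}"
      by (rule keys_D_bracket) (use x y in auto)
    then show ?thesis by (simp add: D_comp_eq)
  qed
next
  fix x assume x: "x \<in> D n"
  show "\<exists>!c. (\<forall>l. c l \<in> D_comp n l) \<and> finite {l. c l \<noteq> 0} \<and> x = (\<Sum>l | c l \<noteq> 0. c l)"
  proof (rule ex1I)
    \<comment> \<open>The projection of \<open>x\<close> to degree \<open>l\<close>: names of any
      other degree are sent to 0.\<close>
    define c where
      "c l = lin_ext (\<lambda>a. if deg a = l then bvec a else 0) x" for l
    have comp: "c l \<in> D_comp n l" for l
      unfolding c_def
      by (rule linear_in_subspace[OF linear_lin_ext])
        (use x in \<open>auto simp: D_comp_eq D_eq subspace_keys\<close>)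
    have zero: "c l = 0" if "l \<notin> deg ` Poly_Mapping.keys x" for l
      using that unfolding c_def lin_ext_def by (auto intro!: sum.neutral)
    then have sub: "{l. c l \<noteq> 0} \<subseteq> deg ` Poly_Mapping.keys x" by auto
    have "(\<Sum>l | c l \<noteq> 0. c l) = (\<Sum>l\<in>deg ` Poly_Mapping.keys x. c l)"
      by (rule sum.mono_neutral_left) (use sub in auto)
    \<comment> \<open>After the exchange of sums, each name \<open>a\<close> contributes only at
      \<open>l = deg a\<close>.\<close>
    also have "\<dots> = (\<Sum>a\<in>Poly_Mapping.keys x. \<Sum>l\<in>deg ` Poly_Mapping.keys x.
        Poly_Mapping.lookup x a *\<^sub>R (if deg a = l then bvec a else 0))"
      unfolding c_def lin_ext_def by (rule sum.swap)
    also have "\<dots> = lin_ext bvec x"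
      unfolding lin_ext_def by (intro sum.cong) (auto simp flip: scaleR_sum_right)
    finally have "x = (\<Sum>l | c l \<noteq> 0. c l)" by (simp add: lin_ext_single_id)
    then show "(\<forall>l. c l \<in> D_comp n l) \<and> finite {l. c l \<noteq> 0} \<and> x = (\<Sum>l | c l \<noteq> 0. c l)"
      using comp finite_subset[OF sub] by auto
    \<comment> \<open>Uniqueness: among the components of any decomposition only the one of degree
      \<open>deg a\<close> can have a coefficient at \<open>a\<close>, so \<open>x\<close>
      determines it.\<close>
    have lookup: "Poly_Mapping.lookup (d l) a = (if deg a = l then Poly_Mapping.lookup x a else 0)"
      if d: "(\<forall>l. d l \<in> D_comp n l) \<and> finite {l. d l \<noteq> 0} \<and> x = (\<Sum>l | d l \<noteq> 0. d l)" for d l a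
    proof -
      have other: "Poly_Mapping.lookup (d k) a = 0" if "deg a \<noteq> k" for k
      proof -
        have "a \<notin> Poly_Mapping.keys (d k)"
          using d that by (auto simp: D_comp_eq)
        then show ?thesis by (simp add: in_keys_iff)
      qed
      have "Poly_Mapping.lookup x a = (\<Sum>k | d k \<noteq> 0. Poly_Mapping.lookup (d k) a)"
        using d by (metis (no_types) lookup_sum)
      also have "\<dots> = (\<Sum>k | d k \<noteq> 0. if k = deg a then Poly_Mapping.lookup (d k) a else 0)"
        using other by (intro sum.cong) auto
      also have "\<dots> = Poly_Mapping.lookup (d (deg a)) a"
        using d by auto
      finally show ?thesis using other by auto
    qed
    show "d = c"
      if d: "(\<forall>l. d l \<in> D_comp n l) \<and> finite {l. d l \<noteq> 0} \<and> x = (\<Sum>l | d l \<noteq> 0. d l)" for d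
    proof
      fix l
      show "d l = c l"
        using lookup[OF d] lookup[OF \<open>(\<forall>l. c l \<in> D_comp n l) \<and> _\<close>]
        by (intro poly_mapping_eqI) simp
    qed
  qed
qed

section \<open>Nilpotency\<close>

text \<open>All degrees in \<open>D n\<close> are at least 1, so each further bracket raises the
  least possible degree by at least 1. The series starts at index 0 with \<open>D n\<close> itself,
  hence the strict bound.\<close>

lemma lower_central_D:
  "lower_central (D n) (D_bracket n) k \<subseteq> {x. Poly_Mapping.keys x \<subseteq> {a \<in> D_names n. k < deg a}}"
proof (induction k)
  case 0
  show ?case by (auto simp: D_eq D_names_def)
next
  case (Suc k)
  have "Poly_Mapping.keys (D_bracket n x y) \<subseteq> {a \<in> D_names n. Suc k < deg a}"
    if "x \<in> D n" "y \<in> lower_central (D n) (D_bracket n) k" for x y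
  proof -
    have x: "Poly_Mapping.keys x \<subseteq> D_names n"
      and y: "Poly_Mapping.keys y \<subseteq> {a \<in> D_names n. k < deg a}"
      using that Suc.IH by (auto simp: D_eq)
    show ?thesis
    proof (rule keys_D_bracket)
      fix a b c
      assume "a \<in> Poly_Mapping.keys x" "b \<in> Poly_Mapping.keys y" "c \<in> D_names n"
        "deg c = deg a + deg b"
      moreover from this x y have "0 < deg a" "k < deg b" by (auto simp: D_names_def)
      ultimately show "c \<in> {a \<in> D_names n. Suc k < deg a}" by simp
    qed (use x y in auto)
  qed
  then show ?case
    unfolding lower_central.simps by (intro span_minimal[OF _ subspace_keys]) blast
qed

lemma nilpotent_D: "nilpotent_on (D n) (D_bracket n)"
  unfolding nilpotent_on_def
proof
  have "{a \<in> D_names n. Suc n < deg a} = {}" by (auto simp: D_names_def)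
  then have "lower_central (D n) (D_bracket n) (Suc n) \<subseteq> {0}"
    using lower_central_D[of n "Suc n"] by (simp only: subset_empty keys_eq_empty singleton_conv)
  moreover have "0 \<in> lower_central (D n) (D_bracket n) (Suc n)"
    by (simp add: span_zero)
  ultimately show "lower_central (D n) (D_bracket n) (Suc n) = {0}" by blast
qed


section \<open>The complex structure\<close>

text \<open>On even degrees this pairs $w_{4k+2}$ with $w_{4k+4}$. The subtraction \<open>l - 2\<close> truncates
  only at indices 0 and 1, which do not occur for \<open>W\<close> in \<open>D n\<close>.\<close>

fun J_basis :: "bname \<Rightarrow> (bname \<Rightarrow>\<^sub>0 real)" where
  "J_basis (V l) = bvec (U l)"
| "J_basis (U l) = - bvec (V l)"
| "J_basis (W l) = (if l mod 4 = 2 then bvec (W (l + 2)) else - bvec (W (l - 2)))"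

lemmas linear_J = linear_lin_ext[of J_basis]

lemmas J_linear = linear_add[OF linear_J] linear_cmul[OF linear_J] linear_neg[OF linear_J]
  linear_0[OF linear_J]

text \<open>Here the residue of \<open>n\<close> enters: the largest even number up to
  \<open>n\<close> is divisible by 4, so the partner \<open>l + 2\<close> of an index
  \<open>l\<close> congruent to 2 modulo 4 still fits. The other even indices are positive multiples
  of 4, so \<open>l - 2\<close> stays positive.\<close>

lemma keys_J_basis:
  assumes "n mod 4 \<in> {0, 1}" "a \<in> D_names n"
  shows "Poly_Mapping.keys (J_basis a) \<subseteq> D_names n"
proof (cases a)
  case (W l)
  have "l + 2 \<le> n" if "l mod 4 = 2"
    using that assms W by (auto simp: D_names_def; presburger)
  moreover have "2 < l" if "l mod 4 \<noteq> 2"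
    using that assms W by (auto simp: D_names_def; presburger)
  ultimately show ?thesis using assms W by (auto simp: D_names_def)
qed (use assms in \<open>auto simp: D_names_def\<close>)

lemma J_J_basis:
  assumes "a \<in> D_names n"
  shows "lin_ext J_basis (J_basis a) = - bvec a"
proof (cases a)
  case (W l)
  then have l: "even l" "2 \<le> l"
    using assms by (auto simp: D_names_def dvd_imp_le)
  show ?thesis
  proof (cases "l mod 4 = 2")
    case True
    then have "(l + 2) mod 4 \<noteq> 2" by presburger
    with True show ?thesis by (simp add: W)
  next
    case False
    \<comment> \<open>Removes the truncated subtraction: the partner of \<open>l\<close> is
      \<open>k\<close>, whose residue is 2, so \<open>J_basis\<close> leads back to
      \<open>l\<close>.\<close>
    obtain k where k: "l = k + 2" using l(2) by (metis le_add_diff_inverse2)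
    with False l(1) have "k mod 4 = 2" by presburger
    with False show ?thesis by (simp add: W k J_linear)
  qed
qed (auto simp: J_linear)

text \<open>On the span of the \<open>V\<close> and \<open>U\<close>, J squares to -1 and commutes
  with bracketing by any \<open>W\<close>. So for x there and y a \<open>W\<close>,
  \<open>[Jx, Jy] = J[x, Jy]\<close> and \<open>[x, y] + J[Jx, y] = 0\<close>. For x and y both
  among the \<open>V\<close> and \<open>U\<close>, \<open>[Jx, Jy] = [x, y]\<close>, and the two
  terms under J vanish or cancel. Two \<open>W\<close> give only zeros. How J pairs the
  \<open>W\<close> does not affect this argument.\<close>

lemma nijenhuis_basis:
  "D_bracket n (J_basis a) (J_basis b) = basis_bracket n a b
    + lin_ext J_basis (D_bracket n (J_basis a) (bvec b))
    + lin_ext J_basis (D_bracket n (bvec a) (J_basis b))"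
  by (cases a; cases b)
    (auto simp: D_bracket_bvec D_bracket_linear J_linear trunc_bvec_def add.commute)

lemma complex_structure_D:
  assumes "n mod 4 \<in> {0, 1}"
  shows "complex_structure_on (D n) (D_bracket n) (lin_ext J_basis)"
  unfolding complex_structure_on_def linear_endomorphism_on_def
proof (intro conjI ballI allI)
  show "lin_ext J_basis x \<in> D n" if "x \<in> D n" for x
    unfolding D_eq
  proof (rule linear_in_subspace[OF linear_J subspace_keys])
    fix a assume "a \<in> Poly_Mapping.keys x"
    then show "lin_ext J_basis (bvec a) \<in> {x. Poly_Mapping.keys x \<subseteq> D_names n}"
      using that keys_J_basis[OF assms, of a] by (auto simp: D_eq)
  qed
  show "lin_ext J_basis (lin_ext J_basis x) = - x" if "x \<in> D n" for x
  proof (rule linear_eq_bvec[where f = "\<lambda>x. lin_ext J_basis (lin_ext J_basis x)" and g = uminus])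
    fix a assume "a \<in> Poly_Mapping.keys x"
    then show "lin_ext J_basis (lin_ext J_basis (bvec a)) = - bvec a"
      using that by (auto simp: D_eq intro!: J_J_basis)
  qed (auto intro!: linearI simp: J_linear)
  show "D_bracket n (lin_ext J_basis x) (lin_ext J_basis y) = D_bracket n x y
      + lin_ext J_basis (D_bracket n (lin_ext J_basis x) y)
      + lin_ext J_basis (D_bracket n x (lin_ext J_basis y))"
    if "x \<in> D n" "y \<in> D n" for x y
  \<comment> \<open>Both sides are bilinear, so integrability need only be checked on pairs of basis
    vectors.\<close>
  proof (rule bilinear_D_bracket_eq[where
        f = "\<lambda>x y. D_bracket n (lin_ext J_basis x) (lin_ext J_basis y)" and
        g = "\<lambda>x y. D_bracket n x y + lin_ext J_basis (D_bracket n (lin_ext J_basis x) y)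
          + lin_ext J_basis (D_bracket n x (lin_ext J_basis y))"])
    fix a b
    show "D_bracket n (lin_ext J_basis (bvec a)) (lin_ext J_basis (bvec b))
        = D_bracket n (bvec a) (bvec b)
          + lin_ext J_basis (D_bracket n (lin_ext J_basis (bvec a)) (bvec b))
          + lin_ext J_basis (D_bracket n (bvec a) (lin_ext J_basis (bvec b)))"
      using nijenhuis_basis[of n a b] by (simp add: D_bracket_bvec)
  qed (auto intro!: linearI simp: J_linear D_bracket_linear scaleR_add_right)
qed (rule J_linear)+

theorem proposition5p3:
  shows "(\<forall>m\<ge>1.
            lie_algebra_on (D (4 * m)) (D_bracket (4 * m)) \<and>
            positive_grading_on (D (4 * m)) (D_bracket (4 * m)) (D_comp (4 * m)) \<and>
            nilpotent_on (D (4 * m)) (D_bracket (4 * m)) \<and>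
            (\<exists>J. complex_structure_on (D (4 * m)) (D_bracket (4 * m)) J)) \<and>
         (\<forall>m.
            lie_algebra_on (D (4 * m + 1)) (D_bracket (4 * m + 1)) \<and>
            positive_grading_on (D (4 * m + 1)) (D_bracket (4 * m + 1)) (D_comp (4 * m + 1)) \<and>
            nilpotent_on (D (4 * m + 1)) (D_bracket (4 * m + 1)) \<and>
            (\<exists>J. complex_structure_on (D (4 * m + 1)) (D_bracket (4 * m + 1)) J))"
proof -
  have "\<exists>J. complex_structure_on (D n) (D_bracket n) J" if "n mod 4 \<in> {0, 1}" for n
    using complex_structure_D[OF that] by blast
  then show ?thesis
    by (simp add: lie_algebra_D positive_grading_D nilpotent_D)
qed

end
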